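(* Let $X=\prod_{n=1}^\infty X_n$ be a product of normed spaces $(X_n,\|\cdot\|_n)$ with $|X_n|>1$ for every $n\in\mathbb N$, and let $a\in X$. Then for any open set $G\subseteq(\sigma(a),\tau)$ there exists a strongly separately continuous function $f:(\sigma(a),\tau)\to\mathbb R$ such that $D(f)=G$.
   Context: For $a=(a_n)_n\in X=\prod_{n=1}^\infty X_n$, $\sigma(a)=\{x=(x_n)_n\in X:\{n\in\mathbb N:x_n\ne a_n\}\text{ is finite}\}$. $\tau$ denotes the Tychonoff product topology on $X$ (each $X_n$ carrying its norm topology) and also the subspace topology it induces on $\sigma(a)$. For $x,b\in\sigma(a)$ and $k\in\mathbb N$, $x_k^b$ denotes the point whose $k$-th coordinate is $b_k$ and whose $n$-th coordinate is $x_n$ for all $n\neq k$ (it belongs to $\sigma(a)$). A function $f:(\sigma(a),\tau)\to\mathbb R$ is strongly separately continuous if for every $b\in\sigma(a)$ and every $k\in\mathbb N$, $\lim_{x\to b}|f(x)-f(x_k^b)|=0$, the limit being taken in $(\sigma(a),\tau)$. $D(f)$ denotes the set of all points of $\sigma(a)$ at which $f:(\sigma(a),\tau)\to\mathbb R$ is not continuous. *)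

theory Defs
  imports "HOL-Analysis.Analysis" "HOL-Algebra.Module"
begin

section \<open>Normed spaces with explicit carriers\<close>

text \<open>
  The spaces \<open>X\<^sub>n\<close> of a product \<open>\<Prod>\<^sub>n X\<^sub>n\<close> vary with \<open>n\<close>, so the type class
  \<open>real_normed_vector\<close>, which provides one space per type, is not applicable.  Each \<open>X\<^sub>n\<close>
  is a carrier set with its own vector space operations and its own norm, the vector space
  part being a module in the sense of HOL-Algebra over the field of reals.  The ring
  multiplication and unit that the module record inherits play no role.
\<close>

definition real_field :: "real ring" where
  "real_field = \<lparr>carrier = UNIV, mult = (*), one = 1, zero = 0, add = (+)\<rparr>"

record 'a normed_module = "(real, 'a) module" +
  vnorm :: "'a \<Rightarrow> real"

locale normed_space = module real_field V
  for V :: "('a, 'b) normed_module_scheme" (structure) +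
  assumes vnorm_nonneg: "x \<in> carrier V \<Longrightarrow> 0 \<le> vnorm V x"
    and vnorm_eq_zero_iff: "x \<in> carrier V \<Longrightarrow> vnorm V x = 0 \<longleftrightarrow> x = \<zero>\<^bsub>V\<^esub>"
    and vnorm_smult: "x \<in> carrier V \<Longrightarrow> vnorm V (c \<odot>\<^bsub>V\<^esub> x) = \<bar>c\<bar> * vnorm V x"
    and vnorm_triangle:
      "\<lbrakk>x \<in> carrier V; y \<in> carrier V\<rbrakk> \<Longrightarrow> vnorm V (x \<oplus>\<^bsub>V\<^esub> y) \<le> vnorm V x + vnorm V y"

text \<open>
  The value \<open>0\<close> off the carrier is there because \<^locale>\<open>Metric_space\<close> requires symmetry and
  nonnegativity on the whole type.  It does not affect the topology.
\<close>

definition norm_dist :: "('a, 'b) normed_module_scheme \<Rightarrow> 'a \<Rightarrow> 'a \<Rightarrow> real" where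
  "norm_dist V x y =
     (if x \<in> carrier V \<and> y \<in> carrier V then vnorm V (x \<ominus>\<^bsub>V\<^esub> y) else 0)"

definition norm_topology :: "('a, 'b) normed_module_scheme \<Rightarrow> 'a topology" where
  "norm_topology V = Metric_space.mtopology (carrier V) (norm_dist V)"

section \<open>The space \<open>\<sigma>(a)\<close>\<close>

definition prod_space :: "(nat \<Rightarrow> ('a, 'b) normed_module_scheme) \<Rightarrow> (nat \<Rightarrow> 'a) set" where
  "prod_space X = (\<Pi>\<^sub>E n\<in>UNIV. carrier (X n))"

definition sigma ::
  "(nat \<Rightarrow> ('a, 'b) normed_module_scheme) \<Rightarrow> (nat \<Rightarrow> 'a) \<Rightarrow> (nat \<Rightarrow> 'a) set" where
  "sigma X a = {x \<in> prod_space X. finite {n. x n \<noteq> a n}}"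

definition tau ::
  "(nat \<Rightarrow> ('a, 'b) normed_module_scheme) \<Rightarrow> (nat \<Rightarrow> 'a) \<Rightarrow> (nat \<Rightarrow> 'a) topology" where
  "tau X a = subtopology (product_topology (\<lambda>n. norm_topology (X n)) UNIV) (sigma X a)"

section \<open>Strong separate continuity and discontinuity points\<close>

text \<open>
  Functions on \<open>\<sigma>(a)\<close> are total functions whose values off \<open>\<sigma>(a)\<close> are irrelevant.
  The point \<open>x\<^sub>k\<^sup>b\<close> is \<open>x(k := b k)\<close>.  The filter \<open>atin\<close> omits the point \<open>b\<close> itself,
  at which the expression vanishes anyway.
\<close>

definition strongly_separately_continuous ::
  "(nat \<Rightarrow> ('a, 'b) normed_module_scheme) \<Rightarrow> (nat \<Rightarrow> 'a) \<Rightarrow> ((nat \<Rightarrow> 'a) \<Rightarrow> real) \<Rightarrow> bool" where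
  "strongly_separately_continuous X a f \<longleftrightarrow>
     (\<forall>b \<in> sigma X a. \<forall>k. ((\<lambda>x. \<bar>f x - f (x(k := b k))\<bar>) \<longlongrightarrow> 0) (atin (tau X a) b))"

definition disc_points ::
  "(nat \<Rightarrow> ('a, 'b) normed_module_scheme) \<Rightarrow> (nat \<Rightarrow> 'a) \<Rightarrow> ((nat \<Rightarrow> 'a) \<Rightarrow> real) \<Rightarrow> (nat \<Rightarrow> 'a) set" where
  "disc_points X a f = {x \<in> sigma X a. \<not> topcontinuous_at (tau X a) euclideanreal f x}"

section \<open>Basic facts\<close>

lemma cring_real_field: "cring real_field"
proof (rule cringI)
  show "abelian_group real_field"
  proof (rule abelian_groupI)
    fix x assume "x \<in> carrier real_field"
    show "\<exists>y\<in>carrier real_field. y \<oplus>\<^bsub>real_field\<^esub> x = \<zero>\<^bsub>real_field\<^esub>"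
      by (rule bexI[of _ "- x"]) (auto simp: real_field_def)
  qed (auto simp: real_field_def)
  show "comm_monoid real_field"
    by (rule comm_monoidI) (auto simp: real_field_def)
qed (auto simp: real_field_def distrib_right)

context normed_space
begin

lemma vnorm_minus: "x \<in> carrier V \<Longrightarrow> vnorm V (\<ominus>\<^bsub>V\<^esub> x) = vnorm V x"
proof -
  assume x: "x \<in> carrier V"
  have "(-1) \<odot>\<^bsub>V\<^esub> x \<oplus>\<^bsub>V\<^esub> x = ((-1) \<oplus>\<^bsub>real_field\<^esub> 1) \<odot>\<^bsub>V\<^esub> x"
    using smult_l_distr[of "-1" 1 x] smult_one[of x] x by (simp add: real_field_def)
  also have "\<dots> = \<zero>\<^bsub>V\<^esub>"
    using smult_l_null[of x] x by (simp add: real_field_def)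
  finally have "(-1) \<odot>\<^bsub>V\<^esub> x = \<ominus>\<^bsub>V\<^esub> x"
    using x smult_closed[of "-1" x] by (simp add: M.minus_equality real_field_def)
  then show ?thesis
    using vnorm_smult[of x "-1"] x by simp
qed

lemma Metric_space_norm_dist: "Metric_space (carrier V) (norm_dist V)"
proof
  fix x y z
  show "0 \<le> norm_dist V x y"
    by (simp add: norm_dist_def vnorm_nonneg)
  show "norm_dist V x y = norm_dist V y x"
  proof -
    have "vnorm V (x \<ominus>\<^bsub>V\<^esub> y) = vnorm V (y \<ominus>\<^bsub>V\<^esub> x)" if "x \<in> carrier V" "y \<in> carrier V"
      using vnorm_minus[of "x \<ominus>\<^bsub>V\<^esub> y"] that
      by (simp add: M.minus_eq M.minus_add M.a_comm)
    then show ?thesis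
      by (simp add: norm_dist_def)
  qed
  show "norm_dist V x y = 0 \<longleftrightarrow> x = y" if "x \<in> carrier V" "y \<in> carrier V"
  proof -
    have "x \<ominus>\<^bsub>V\<^esub> y = \<zero>\<^bsub>V\<^esub> \<longleftrightarrow> x = y"
      using that M.minus_equality[of x "\<ominus>\<^bsub>V\<^esub> y"] by (auto simp: M.minus_eq M.r_neg)
    then show ?thesis
      using that by (simp add: norm_dist_def vnorm_eq_zero_iff)
  qed
  show "norm_dist V x z \<le> norm_dist V x y + norm_dist V y z"
    if "x \<in> carrier V" "y \<in> carrier V" "z \<in> carrier V"
  proof -
    have "x \<ominus>\<^bsub>V\<^esub> z = (x \<ominus>\<^bsub>V\<^esub> y) \<oplus>\<^bsub>V\<^esub> (y \<ominus>\<^bsub>V\<^esub> z)"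
      using that by (simp add: M.minus_eq M.a_assoc M.r_neg1)
    then show ?thesis
      using that vnorm_triangle[of "x \<ominus>\<^bsub>V\<^esub> y" "y \<ominus>\<^bsub>V\<^esub> z"] by (simp add: norm_dist_def)
  qed
qed

end

lemma topspace_tau:
  assumes "\<And>n. normed_space (X n)"
  shows "topspace (tau X a) = sigma X a"
proof -
  have "topspace (norm_topology (X n)) = carrier (X n)" for n
    unfolding norm_topology_def
    by (rule Metric_space.topspace_mtopology[OF normed_space.Metric_space_norm_dist[OF assms]])
  then show ?thesis
    by (auto simp: tau_def sigma_def prod_space_def)
qed

end

theory Submission
  imports Defs
begin

text \<open>
  The finite sum \<open>S x = \<Sum>n. \<parallel>x\<^sub>n - a\<^sub>n\<parallel>\<close> depends continuously on each single coordinate,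
  with increments that do not depend on the others, but moving a far-out coordinate changes it
  by an arbitrary amount within any neighbourhood.  Hence \<open>cos \<circ> S\<close> is bounded, strongly
  separately continuous and nowhere continuous.  The space \<open>\<sigma>(a)\<close> is metrizable, so there is
  a continuous \<open>\<phi>\<close> with \<open>G = {x. \<phi> x \<noteq> 0}\<close>, and \<open>f = \<phi> \<cdot> (cos \<circ> S)\<close> is discontinuous
  exactly on \<open>G\<close>.
\<close>

section \<open>Open sets as cozero sets\<close>

text \<open>The distance to the complement of \<open>U\<close> serves: it is 1-Lipschitz, zero on
  the complement, and at least \<open>r\<close> at the centre of a ball of radius \<open>r\<close>
  inside \<open>U\<close>.\<close>

lemma metrizable_space_openin_cozero:
  assumes "metrizable_space X" and "openin X U"
  obtains \<phi> :: "'a \<Rightarrow> real"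
  where "continuous_map X euclideanreal \<phi>" and "\<And>x. x \<in> topspace X \<Longrightarrow> \<phi> x \<noteq> 0 \<longleftrightarrow> x \<in> U"
proof -
  from assms(1) obtain M d where Md: "Metric_space M d" and X: "X = Metric_space.mtopology M d"
    by (auto simp: metrizable_space_def)
  interpret Metric_space M d by (fact Md)
  have UM: "U \<subseteq> M"
    using openin_subset[OF assms(2)] by (simp add: X)
  show thesis
  proof (cases "U = M")
    \<comment> \<open>Here the complement is empty, so there is no distance to take; a nonzero
      constant replaces it.\<close>
    case True
    then show thesis
      using that[of "\<lambda>_. 1"] by (simp add: X)
  next
    case False
    define C where "C = M - U"
    have C: "C \<noteq> {}" "C \<subseteq> M"
      using False UM by (auto simp: C_def)
    define \<phi> where "\<phi> x = (INF y\<in>C. d x y)" for x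
    have bdd: "bdd_below (d x ` C)" for x
      by (rule bdd_belowI2[of _ 0]) simp
    have le: "\<phi> x \<le> d x y + \<phi> y" if "x \<in> M" "y \<in> M" for x y
    proof -
      have "\<phi> x - d x y \<le> d y z" if "z \<in> C" for z
      proof -
        have "\<phi> x \<le> d x z"
          unfolding \<phi>_def by (rule cINF_lower[OF bdd that])
        also have "\<dots> \<le> d x y + d y z"
          using C(2) that \<open>x \<in> M\<close> \<open>y \<in> M\<close> by (intro triangle) auto
        finally show ?thesis by simp
      qed
      then have "\<phi> x - d x y \<le> \<phi> y"
        unfolding \<phi>_def[of y] by (intro cINF_greatest C(1))
      then show ?thesis by simp
    qed
    have Lip: "\<bar>\<phi> x - \<phi> y\<bar> \<le> d x y" if "x \<in> M" "y \<in> M" for x y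
      using le[OF that] le[OF that(2,1)] commute[of x y] by linarith
    have "Lipschitz_continuous_map Self euclidean_metric \<phi>"
      unfolding Lipschitz_continuous_map_def
      by (auto simp: Self_def dist_real_def Lip intro!: exI[of _ 1])
    then have "continuous_map X euclideanreal \<phi>"
      using Lipschitz_continuous_imp_continuous_map by (force simp: X Self_def)
    moreover have "\<phi> x \<noteq> 0 \<longleftrightarrow> x \<in> U" if x: "x \<in> topspace X" for x
    proof
      assume "x \<in> U"
      then obtain r where r: "r > 0" "mball x r \<subseteq> U"
        using assms(2) by (auto simp: X openin_mtopology)
      have "r \<le> d x y" if "y \<in> C" for y
        using r that x C(2) by (force simp: C_def X mball_def not_le[symmetric])
      then have "r \<le> \<phi> x"
        unfolding \<phi>_def by (intro cINF_greatest C(1))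
      with r(1) show "\<phi> x \<noteq> 0" by simp
    next
      assume "\<phi> x \<noteq> 0"
      show "x \<in> U"
      proof (rule ccontr)
        assume "x \<notin> U"
        with x have "x \<in> C" by (simp add: C_def X)
        then have "\<phi> x \<le> d x x"
          unfolding \<phi>_def by (rule cINF_lower[OF bdd])
        moreover have "0 \<le> \<phi> x"
          unfolding \<phi>_def by (intro cINF_greatest C(1)) simp
        ultimately show False
          using \<open>\<phi> x \<noteq> 0\<close> x by (simp add: X)
      qed
    qed
    ultimately show thesis by (rule that)
  qed
qed

section \<open>Prescribed distances and the sum of norms\<close>

text \<open>A nonzero vector is scaled to norm \<open>t\<close> and added to \<open>p\<close>. This
  lets a single coordinate change the sum of norms by any prescribed nonnegative amount.\<close>

lemma (in normed_space) exists_norm_dist_eq: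
  assumes "\<exists>x\<in>carrier V. \<exists>y\<in>carrier V. x \<noteq> y" and "p \<in> carrier V" and "0 \<le> t"
  obtains c where "c \<in> carrier V" and "norm_dist V c p = t"
proof -
  obtain v where v: "v \<in> carrier V" "v \<noteq> \<zero>\<^bsub>V\<^esub>"
    using assms(1) by metis
  have nv: "vnorm V v > 0"
    using vnorm_nonneg[OF v(1)] vnorm_eq_zero_iff[OF v(1)] v(2) by linarith
  define w where "w = (t / vnorm V v) \<odot>\<^bsub>V\<^esub> v"
  have w: "w \<in> carrier V"
    using v(1) by (simp add: w_def real_field_def)
  have "(w \<oplus>\<^bsub>V\<^esub> p) \<ominus>\<^bsub>V\<^esub> p = w"
    using w assms(2) by (simp add: M.minus_eq M.a_assoc M.r_neg)
  moreover have "vnorm V w = t"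
    using vnorm_smult[OF v(1)] nv assms(3) by (simp add: w_def)
  ultimately have "norm_dist V (w \<oplus>\<^bsub>V\<^esub> p) p = t"
    using w assms(2) by (simp add: norm_dist_def)
  then show thesis
    using that w assms(2) by blast
qed

text \<open>Restricting the index set to the coordinates where \<open>x\<close> leaves
  \<open>a\<close> makes this a genuine finite sum on \<open>sigma X a\<close>, with no question of
  convergence.\<close>

definition norm_sum ::
  "(nat \<Rightarrow> ('a, 'b) normed_module_scheme) \<Rightarrow> (nat \<Rightarrow> 'a) \<Rightarrow> (nat \<Rightarrow> 'a) \<Rightarrow> real" where
  "norm_sum X a x = (\<Sum>n | x n \<noteq> a n. norm_dist (X n) (x n) (a n))"

context
  fixes X :: "nat \<Rightarrow> ('a, 'b) normed_module_scheme" and a :: "nat \<Rightarrow> 'a"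
  assumes X: "\<And>n. normed_space (X n)"
begin

lemma sigma_upd:
  assumes "x \<in> sigma X a" and "c \<in> carrier (X k)"
  shows "x(k := c) \<in> sigma X a"
proof -
  have "finite {n. (x(k := c)) n \<noteq> a n}"
    by (rule finite_subset[of _ "insert k {n. x n \<noteq> a n}"]) (use assms(1) in \<open>auto simp: sigma_def\<close>)
  then show ?thesis
    using assms by (auto simp: sigma_def prod_space_def PiE_iff)
qed

lemma sigma_carrier: "x \<in> sigma X a \<Longrightarrow> x n \<in> carrier (X n)"
  by (auto simp: sigma_def prod_space_def)

lemma norm_sum_upd:
  assumes a: "a \<in> prod_space X" and x: "x \<in> sigma X a"
  shows "norm_sum X a (x(k := c)) =
    norm_sum X a x - norm_dist (X k) (x k) (a k) + norm_dist (X k) c (a k)"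
proof -
  \<comment> \<open>Index \<open>k\<close> may enter or leave the summation set when coordinate
    \<open>k\<close> is replaced. \<open>F\<close> contains both summation sets, and the added terms
    vanish, so the two sums can be compared term by term.\<close>
  define F where "F = insert k {n. x n \<noteq> a n}"
  have F: "finite F" "k \<in> F"
    using x by (auto simp: F_def sigma_def)
  have d0: "norm_dist (X n) (a n) (a n) = 0" for n
    using a Metric_space.mdist_zero[OF normed_space.Metric_space_norm_dist[OF X]]
    by (auto simp: prod_space_def)
  have S: "norm_sum X a y = norm_dist (X k) (y k) (a k)
      + (\<Sum>n\<in>F - {k}. norm_dist (X n) (y n) (a n))" if "{n. y n \<noteq> a n} \<subseteq> F" for y
  proof -
    have "norm_sum X a y = (\<Sum>n\<in>F. norm_dist (X n) (y n) (a n))"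
      unfolding norm_sum_def using F that d0 by (intro sum.mono_neutral_left) auto
    then show ?thesis
      by (simp add: sum.remove[OF F])
  qed
  have "(\<Sum>n\<in>F - {k}. norm_dist (X n) ((x(k := c)) n) (a n))
      = (\<Sum>n\<in>F - {k}. norm_dist (X n) (x n) (a n))"
    by (intro sum.cong) auto
  moreover have "{n. (x(k := c)) n \<noteq> a n} \<subseteq> F" "{n. x n \<noteq> a n} \<subseteq> F"
    by (auto simp: F_def)
  ultimately show ?thesis
    using S[of "x(k := c)"] S[of x] by simp
qed

section \<open>The topology of \<sigma>(a)\<close>

lemma topspace_norm_topology: "topspace (norm_topology (X n)) = carrier (X n)"
  unfolding norm_topology_def
  by (rule Metric_space.topspace_mtopology[OF normed_space.Metric_space_norm_dist[OF X]])

lemma metrizable_space_tau: "metrizable_space (tau X a)"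
proof -
  have "metrizable_space (norm_topology (X n))" for n
    unfolding norm_topology_def
    by (rule Metric_space.metrizable_space_mtopology[OF normed_space.Metric_space_norm_dist[OF X]])
  then show ?thesis
    unfolding tau_def
    by (intro metrizable_space_subtopology) (simp add: metrizable_space_product_topology)
qed

lemma continuous_map_tau_coordinate:
  "continuous_map (tau X a) (norm_topology (X n)) (\<lambda>x. x n)"
  unfolding tau_def
  by (intro continuous_map_from_subtopology continuous_map_product_coordinates UNIV_I)

text \<open>Coordinate \<open>k\<close> of the image is constant and every other coordinate is a
  projection. Composition with this map makes \<phi>(x(k := c)) continuous in x.\<close>

lemma continuous_map_tau_upd:
  assumes "c \<in> carrier (X k)"
  shows "continuous_map (tau X a) (tau X a) (\<lambda>x. x(k := c))"
proof -
  have "continuous_map (tau X a) (norm_topology (X n)) (\<lambda>x. (x(k := c)) n)" for n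
    using assms continuous_map_tau_coordinate by (cases "n = k") (auto simp: topspace_norm_topology)
  then have "continuous_map (tau X a) (product_topology (\<lambda>n. norm_topology (X n)) UNIV)
      (\<lambda>x. x(k := c))"
    by (simp add: continuous_map_componentwise_UNIV)
  then show ?thesis
    using sigma_upd[OF _ assms] topspace_tau[OF X]
    by (subst (2) tau_def) (auto simp: continuous_map_in_subtopology)
qed

lemma continuous_map_tau_norm_dist:
  assumes "p \<in> carrier (X n)"
  shows "continuous_map (tau X a) euclideanreal (\<lambda>x. norm_dist (X n) (x n) p)"
proof -
  interpret Metric_space "carrier (X n)" "norm_dist (X n)"
    by (rule normed_space.Metric_space_norm_dist[OF X])
  have "continuous_map (tau X a) (mtopology_of Self) (\<lambda>x. x n)"
    using continuous_map_tau_coordinate[of n] by (simp add: norm_topology_def Self_def)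
  moreover have "continuous_map (tau X a) (mtopology_of Self) (\<lambda>x. p)"
    using assms by (simp add: Self_def)
  ultimately have "continuous_map (tau X a) euclideanreal (\<lambda>x. mdist Self (x n) p)"
    by (rule continuous_map_mdist)
  then show ?thesis
    by (simp add: Self_def)
qed

text \<open>Coordinate \<open>n\<close> is altered only at stage \<open>m = n\<close>, hence is
  constant from \<open>Suc n\<close> on. Convergence is coordinatewise, so no bound on the size of
  the changes \<open>c m\<close> is required.\<close>

lemma limitin_tau_upd:
  assumes b: "b \<in> sigma X a" and c: "\<And>n. c n \<in> carrier (X n)"
  shows "limitin (tau X a) (\<lambda>m. b(m := c m)) b sequentially"
proof -
  have "limitin (norm_topology (X n)) (\<lambda>m. (b(m := c m)) n) (b n) sequentially" for n
    using sigma_carrier[OF b]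
    by (intro limitin_eventually eventually_sequentiallyI[of "Suc n"])
       (auto simp: topspace_norm_topology)
  then show ?thesis
    unfolding tau_def limitin_subtopology
    using b c sigma_upd[OF b] sigma_carrier[OF b]
    by (auto simp: limitin_componentwise topspace_norm_topology PiE_UNIV_domain)
qed

section \<open>The function \<phi> times the cosine of the sum of norms\<close>

lemma strongly_separately_continuous_times_cos_norm_sum:
  assumes a: "a \<in> prod_space X" and \<phi>: "continuous_map (tau X a) euclideanreal \<phi>"
  shows "strongly_separately_continuous X a (\<lambda>x. \<phi> x * cos (norm_sum X a x))"
  unfolding strongly_separately_continuous_def
proof (intro ballI allI)
  fix b k
  assume b: "b \<in> sigma X a"
  have bk: "b k \<in> carrier (X k)" and ak: "a k \<in> carrier (X k)"
    using b a by (auto simp: sigma_def prod_space_def)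
  \<comment> \<open>This majorant comes from p cos s - p' cos s' = p (cos s - cos s') + (p - p') cos
    s', where cos is 1-Lipschitz and bounded by 1. The discontinuous sum enters only through its
    increment s - s', which depends on coordinate \<open>k\<close> alone, so \<open>e\<close> is
    continuous and vanishes at \<open>b\<close>.\<close>
  define e where "e x = \<bar>\<phi> x - \<phi> (x(k := b k))\<bar>
      + \<bar>\<phi> x\<bar> * \<bar>norm_dist (X k) (x k) (a k) - norm_dist (X k) (b k) (a k)\<bar>" for x
  have \<phi>': "continuous_map (tau X a) euclideanreal (\<lambda>x. \<phi> (x(k := b k)))"
    using continuous_map_compose[OF continuous_map_tau_upd[OF bk] \<phi>] by (simp add: o_def)
  have "continuous_map (tau X a) euclideanreal e"
    unfolding e_def
    by (intro continuous_intros \<phi> \<phi>' continuous_map_tau_norm_dist ak) auto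
  moreover have "e b = 0"
    by (simp add: e_def)
  ultimately have e: "(e \<longlongrightarrow> 0) (atin (tau X a) b)"
    using limitin_continuous_map[of "tau X a" euclideanreal e b 0] b
    by (simp add: topspace_tau[OF X])
  have bound: "\<bar>\<phi> x * cos (norm_sum X a x) - \<phi> (x(k := b k)) * cos (norm_sum X a (x(k := b k)))\<bar>
      \<le> e x" if x: "x \<in> sigma X a" for x
  proof -
    define s s' p p' where defs: "s = norm_sum X a x" "s' = norm_sum X a (x(k := b k))"
      "p = \<phi> x" "p' = \<phi> (x(k := b k))"
    have "\<bar>cos s - cos s'\<bar> \<le> \<bar>s - s'\<bar>"
    proof -
      \<comment> \<open>The difference of cosines is twice a product of these two sines, so this
        bound gives the Lipschitz constant 1.\<close>
      have "\<bar>sin ((s + s') / 2)\<bar> * \<bar>sin ((s' - s) / 2)\<bar> \<le> 1 * \<bar>(s' - s) / 2\<bar>"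
        by (intro mult_mono abs_sin_x_le_abs_x) simp_all
      then show ?thesis
        by (simp add: cos_diff_cos abs_mult)
    qed
    then have "\<bar>p\<bar> * \<bar>cos s - cos s'\<bar> \<le> \<bar>p\<bar> * \<bar>s - s'\<bar>"
      by (rule mult_left_mono) simp
    moreover have "\<bar>p - p'\<bar> * \<bar>cos s'\<bar> \<le> \<bar>p - p'\<bar>"
      by (rule mult_left_le) simp_all
    moreover have "p * cos s - p' * cos s' = p * (cos s - cos s') + (p - p') * cos s'"
      by (simp add: algebra_simps)
    then have "\<bar>p * cos s - p' * cos s'\<bar> \<le> \<bar>p\<bar> * \<bar>cos s - cos s'\<bar> + \<bar>p - p'\<bar> * \<bar>cos s'\<bar>"
      by (metis abs_mult abs_triangle_ineq)
    moreover have "s - s' = norm_dist (X k) (x k) (a k) - norm_dist (X k) (b k) (a k)"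
      using norm_sum_upd[OF a x] by (simp add: defs)
    ultimately show ?thesis
      by (simp add: e_def defs)
  qed
  show "((\<lambda>x. \<bar>\<phi> x * cos (norm_sum X a x)
      - \<phi> (x(k := b k)) * cos (norm_sum X a (x(k := b k)))\<bar>) \<longlongrightarrow> 0) (atin (tau X a) b)"
  proof (rule Lim_null_comparison[OF _ e])
    show "\<forall>\<^sub>F x in atin (tau X a) b. norm \<bar>\<phi> x * cos (norm_sum X a x)
      - \<phi> (x(k := b k)) * cos (norm_sum X a (x(k := b k)))\<bar> \<le> e x"
      unfolding eventually_atin
      using b bound openin_topspace[of "tau X a"] by (auto simp: topspace_tau[OF X])
  qed
qed

text \<open>At a zero of \<phi>, the bound |f| \<le> |\<phi>| squeezes f to 0. At any other point
  \<open>b\<close>, altering one coordinate ever further out gives a sequence converging to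
  \<open>b\<close> along which the cosine is eventually constant but different from its value at
  \<open>b\<close>.\<close>

lemma disc_points_times_cos_norm_sum:
  assumes a: "a \<in> prod_space X" and nontrivial: "\<And>n. \<exists>x\<in>carrier (X n). \<exists>y\<in>carrier (X n). x \<noteq> y"
    and \<phi>: "continuous_map (tau X a) euclideanreal \<phi>"
  shows "disc_points X a (\<lambda>x. \<phi> x * cos (norm_sum X a x)) = {x \<in> sigma X a. \<phi> x \<noteq> 0}"
proof -
  define f where "f x = \<phi> x * cos (norm_sum X a x)" for x
  have cont: "topcontinuous_at (tau X a) euclideanreal f b" if b: "b \<in> sigma X a" and "\<phi> b = 0" for b
  proof -
    have "(\<phi> \<longlongrightarrow> 0) (atin (tau X a) b)"
      using limitin_continuous_map[OF \<phi>, of b 0] that by (simp add: topspace_tau[OF X])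
    then have "((\<lambda>x. \<bar>\<phi> x\<bar>) \<longlongrightarrow> 0) (atin (tau X a) b)"
      by (rule tendsto_rabs_zero)
    then have "(f \<longlongrightarrow> 0) (atin (tau X a) b)"
      by (rule Lim_null_comparison[rotated])
         (auto intro!: always_eventually mult_left_le simp: f_def abs_mult)
    then show ?thesis
      using that by (simp add: topcontinuous_at_atin topspace_tau[OF X] f_def)
  qed
  have disc: "\<not> topcontinuous_at (tau X a) euclideanreal f b"
    if b: "b \<in> sigma X a" and nz: "\<phi> b \<noteq> 0" for b
  proof
    assume ct: "topcontinuous_at (tau X a) euclideanreal f b"
    let ?s = "norm_sum X a b"
    \<comment> \<open>A shift by \<open>pi\<close> flips the sign of a nonzero cosine. If the cosine
      is zero, a shift by \<open>pi / 2\<close> gives minus the sine, which is then nonzero.\<close>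
    obtain t where t: "0 \<le> t" "cos (?s + t) \<noteq> cos ?s"
    proof (cases "cos ?s = 0")
      case True
      then have "sin ?s \<noteq> 0"
        using sin_cos_squared_add[of ?s] by auto
      with True show thesis
        by (intro that[of "pi / 2"]) (simp_all add: cos_add)
    next
      case False
      then show thesis
        by (intro that[of pi]) simp_all
    qed
    have "\<forall>n. \<exists>c. c \<in> carrier (X n) \<and> norm_dist (X n) c (a n) = t"
      using normed_space.exists_norm_dist_eq[OF X nontrivial _ t(1)] a
      by (metis (mono_tags, lifting) PiE_mem UNIV_I prod_space_def)
    then obtain c where c: "\<And>n. c n \<in> carrier (X n)" "\<And>n. norm_dist (X n) (c n) (a n) = t"
      by metis
    define y where "y m = b(m := c m)" for m
    have y: "limitin (tau X a) y b sequentially"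
      using limitin_tau_upd[OF b c(1)] by (simp add: y_def[abs_def])
    have "(\<lambda>m. \<phi> (y m)) \<longlonglongrightarrow> \<phi> b"
      using continuous_map_limit[OF \<phi> y] by (simp add: o_def)
    then have "(\<lambda>m. \<phi> (y m) * cos (?s + t)) \<longlonglongrightarrow> \<phi> b * cos (?s + t)"
      by (intro tendsto_intros)
    moreover have "finite {n. b n \<noteq> a n}"
      using b by (simp add: sigma_def)
    \<comment> \<open>From \<open>N\<close> on, \<open>b\<close> agrees with \<open>a\<close>, so
      the replaced summand was 0 and the sum grows by exactly \<open>t\<close>.\<close>
    then obtain N where N: "\<And>n. n \<ge> N \<Longrightarrow> b n = a n"
      by (auto simp: finite_nat_set_iff_bounded not_less[symmetric])
    have "f (y m) = \<phi> (y m) * cos (?s + t)" if "m \<ge> N" for m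
    proof -
      have "norm_dist (X m) (a m) (a m) = 0"
        using a Metric_space.mdist_zero[OF normed_space.Metric_space_norm_dist[OF X]]
        by (auto simp: prod_space_def)
      then show ?thesis
        using norm_sum_upd[OF a b, of m "c m"] N[OF that] c(2)[of m] by (simp add: f_def y_def)
    qed
    then have "\<forall>\<^sub>F m in sequentially. \<phi> (y m) * cos (?s + t) = f (y m)"
      by (auto intro!: eventually_sequentiallyI[of N])
    ultimately have "(\<lambda>m. f (y m)) \<longlonglongrightarrow> \<phi> b * cos (?s + t)"
      by (rule Lim_transform_eventually)
    moreover have "(\<lambda>m. f (y m)) \<longlonglongrightarrow> f b"
    proof (rule topological_tendstoI)
      fix V assume "open V" "f b \<in> V"
      then obtain U where U: "openin (tau X a) U" "b \<in> U" "\<forall>x\<in>U. f x \<in> V"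
        using ct by (auto simp: topcontinuous_at_def)
      then show "\<forall>\<^sub>F m in sequentially. f (y m) \<in> V"
        using limitinD[OF y U(1,2)] by (auto elim: eventually_mono)
    qed
    ultimately have "\<phi> b * cos (?s + t) = f b"
      by (rule LIMSEQ_unique)
    with nz t(2) show False
      by (simp add: f_def)
  qed
  show ?thesis
    using cont disc unfolding disc_points_def f_def[abs_def] by blast
qed

end

theorem theorem4p1:
  fixes X :: "nat \<Rightarrow> 'a normed_module"
    and a :: "nat \<Rightarrow> 'a"
    and G :: "(nat \<Rightarrow> 'a) set"
  assumes "\<And>n. normed_space (X n)"
    and "\<And>n. \<exists>x \<in> carrier (X n). \<exists>y \<in> carrier (X n). x \<noteq> y"
    and "a \<in> prod_space X"
    and "openin (tau X a) G"
  shows "\<exists>f :: (nat \<Rightarrow> 'a) \<Rightarrow> real.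
           strongly_separately_continuous X a f \<and> disc_points X a f = G"
proof -
  obtain \<phi> where \<phi>: "continuous_map (tau X a) euclideanreal \<phi>"
    and nz: "\<And>x. x \<in> topspace (tau X a) \<Longrightarrow> \<phi> x \<noteq> 0 \<longleftrightarrow> x \<in> G"
    using metrizable_space_openin_cozero[OF metrizable_space_tau[OF assms(1)] assms(4)] by blast
  \<comment> \<open>The values of \<phi> are controlled only on \<open>sigma X a\<close>, which
    contains \<open>G\<close> because \<open>G\<close> is open there.\<close>
  have "{x \<in> sigma X a. \<phi> x \<noteq> 0} = G"
    using nz openin_subset[OF assms(4)] topspace_tau[OF assms(1), where a = a] by auto
  then show ?thesis
    using strongly_separately_continuous_times_cos_norm_sum[OF assms(1,3) \<phi>]
      disc_points_times_cos_norm_sum[OF assms(1,3,2) \<phi>] by metis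
qed

end
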